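(* Let $d$ and $n$ be integers with $d\ge 4$ and $n\ge d^2+2d$. Then every root $a\in\mathbb{C}$ of the Ehrhart polynomial $i(\Delta(d,n),m)$ (in the variable $m$) of the hypersimplex $\Delta(d,n)$ satisfies $-\frac{n}{d}<\mathrm{Re}(a)$.
   Context: For integers $1\le d<n$, the hypersimplex $\Delta(d,n)\subset\mathbb{R}^n$ is the convex hull of the points $\mathbf{e}_{i_1}+\cdots+\mathbf{e}_{i_d}$ with $1\le i_1<\cdots<i_d\le n$, where $\mathbf{e}_j$ is the $j$-th unit coordinate vector of $\mathbb{R}^n$. For an integral convex polytope $\mathcal{P}\subset\mathbb{R}^n$ (all vertices have integer coordinates), put $i(\mathcal{P},m)=|m\mathcal{P}\cap\mathbb{Z}^n|$ for $m=1,2,\ldots$, where $m\mathcal{P}=\{m\alpha \mid \alpha\in\mathcal{P}\}$. This is a polynomial in $m$ of degree $\dim\mathcal{P}$, called the Ehrhart polynomial of $\mathcal{P}$; it is regarded as a polynomial with complex argument. For the hypersimplex it is known that $$i(\Delta(d,n),m)=\sum_{s=0}^{d-1}(-1)^s\binom{n}{s}\binom{(d-s)m+n-1-s}{n-1},$$ where $\binom{x}{n-1}=\frac{x(x-1)\cdots(x-n+2)}{(n-1)!}$. *)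

theory Defs
  imports "HOL-Analysis.Analysis" "HOL-Computational_Algebra.Polynomial"
begin

text \<open>Ambient dimension is \<open>n = CARD('n)\<close>; a choice of indices
  \<open>i\<^sub>1 < \<dots> < i\<^sub>d\<close> is a \<open>d\<close>-element subset of the index type.\<close>

definition hypersimplex :: "nat \<Rightarrow> (real ^ 'n) set" where
  "hypersimplex d = convex hull {(\<Sum>i\<in>S. axis i 1) | S. card S = d}"

definition integer_points :: "(real ^ 'n) set" where
  "integer_points = {x. \<forall>i. x $ i \<in> \<int>}"

definition lattice_point_count :: "(real ^ 'n) set \<Rightarrow> nat \<Rightarrow> nat" where
  "lattice_point_count P m = card ((\<lambda>x. real m *\<^sub>R x) ` P \<inter> integer_points)"

text \<open>The description is meaningful only where a polynomial interpolating the counting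
  function exists, in particular for integral convex polytopes (Ehrhart's theorem).
  Uniqueness is the lemma below.\<close>

definition ehrhart_poly :: "(real ^ 'n) set \<Rightarrow> complex poly" where
  "ehrhart_poly P =
     (THE p. \<forall>m\<ge>1. poly p (of_nat m) = of_nat (lattice_point_count P m))"

lemma ehrhart_poly_eqI:
  assumes "\<And>m. m \<ge> 1 \<Longrightarrow> poly p (of_nat m) = of_nat (lattice_point_count P m)"
  shows "ehrhart_poly P = p"
  unfolding ehrhart_poly_def
proof (rule the_equality)
  show "\<forall>m\<ge>1. poly p (of_nat m) = of_nat (lattice_point_count P m)"
    using assms by blast
next
  fix q :: "complex poly"
  assume q: "\<forall>m\<ge>1. poly q (of_nat m) = of_nat (lattice_point_count P m)"
  have "infinite ((of_nat :: nat \<Rightarrow> complex) ` {1..})"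
    by (simp add: finite_image_iff inj_on_def infinite_Ici)
  moreover have "of_nat ` {1..} \<subseteq> {x. poly (q - p) x = 0}"
    using assms q by auto
  ultimately have "infinite {x. poly (q - p) x = 0}"
    using finite_subset by blast
  then show "q = p"
    using poly_roots_finite[of "q - p"] by auto
qed

end

theory Submission
  imports Defs
begin

text \<open>
  The Ehrhart polynomial of the hypersimplex is an alternating sum over \<open>s < d\<close> of products of
  \<open>n - 1\<close> affine factors. On the half plane \<open>Re a \<le> - n / d\<close> the summand for \<open>s = 0\<close> is larger in
  modulus than all the others together, so the polynomial has no root there.

  In the coordinate \<open>w = - d * a - n\<close>, with \<open>Re w \<ge> 0\<close>, the factors for \<open>s = 0\<close> have the moduli
  \<open>norm (w + k)\<close>, \<open>1 \<le> k < n\<close>, and those for \<open>s\<close> the moduli \<open>norm (\<rho> * w + (k - t))\<close>, where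
  \<open>\<rho> = 1 - s / d\<close> and \<open>t = s * (n / d - 1)\<close>. Sort the numbers \<open>k - t\<close> by absolute value as
  \<open>c 1, c 2, \<dots>\<close> and compare the \<open>k\<close>-th of them with \<open>w + k\<close>: on the right half plane
  \<open>norm (\<rho> * w + c k) / norm (w + k)\<close> is at most the maximum of \<open>\<rho>\<close> and \<open>\<bar>c k\<bar> / k\<close>, a bound
  that no longer depends on \<open>w\<close> (\<open>norm_affine_le\<close>). Two regimes remain.

  If \<open>s \<le> d / 2\<close>, all these maxima are at most \<open>1 - t / (n - 1)\<close>, so their product is at most
  \<open>exp (- t)\<close>, and with \<open>n choose s \<le> n ^ s\<close> the summand is at most \<open>(n * exp (1 - n / d)) ^ s\<close> times
  the leading one (\<open>small_shift_bound\<close>). The base is at most \<open>1 / 5\<close>.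

  If \<open>s \<ge> d / 2\<close>, then \<open>\<rho> \<le> 1 / 2\<close> and, after rounding \<open>t\<close> to an integer \<open>A\<close>, the second entry of
  the maximum always wins. The product telescopes to the reciprocal of \<open>(n - 1) choose A\<close>, which
  lies far enough in the middle of its row of Pascal's triangle to outweigh \<open>2 * d * (n choose s)\<close>
  (\<open>large_shift_bound\<close>).

  The formula for the Ehrhart polynomial comes from identifying the lattice points of the \<open>m\<close>-th
  dilation with multisets of size \<open>d * m\<close> and multiplicities at most \<open>m\<close>
  (\<open>integer_points_dilated_hypersimplex\<close>) and counting these by generating functions
  (\<open>card_bounded_multisets\<close>).
\<close>

section \<open>Multisets with bounded multiplicities\<close>

lemma binomial_eq_prod:
  "of_nat (k + N choose N) = (\<Prod>j=1..N. of_nat k + of_nat j) / (fact N :: 'a :: field_char_0)"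
proof (induction N)
  case (Suc N)
  have "Suc N * (k + Suc N choose Suc N) = (k + Suc N) * (k + N choose N)"
    using Suc_times_binomial[of N "k + N"] by simp
  then have "of_nat (Suc N) * (of_nat (k + Suc N choose Suc N) :: 'a)
      = of_nat (k + Suc N) * of_nat (k + N choose N)"
    by (metis of_nat_mult)
  then have "(of_nat (k + Suc N choose Suc N) :: 'a)
      = of_nat (k + Suc N) * of_nat (k + N choose N) / of_nat (Suc N)"
    by (metis nonzero_mult_div_cancel_left of_nat_neq_0)
  also have "\<dots> = (\<Prod>j=1..Suc N. of_nat k + of_nat j) / fact (Suc N)"
    unfolding Suc.IH by (simp add: mult.commute)
  finally show ?case .
qed simp

text \<open>The generating function of these numbers is the power \<open>(1 + X + \<dots> + X^m) ^ card A\<close>.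
  Writing its base as \<open>(1 - X ^ Suc m) / (1 - X)\<close> and expanding numerator and denominator
  separately gives the alternating sum.\<close>

lemma card_bounded_multisets:
  assumes A: "finite A" "card A = Suc N"
  shows "(of_nat (card {X \<in> multisets_of_size A k. \<forall>i. count X i \<le> m}) :: 'a :: field_char_0)
    = (\<Sum>s\<le>Suc N. if s * Suc m \<le> k
        then (-1) ^ s * of_nat (Suc N choose s) * of_nat (k - s * Suc m + N choose N) else 0)"
proof -
  define G :: "'a fps" where "G = Abs_fps (\<lambda>j. if j \<le> m then 1 else 0)"
  have "fps_nth (G ^ Suc N) k = fps_nth (\<Prod>x\<in>A. G) k"
    by (simp add: A)
  also have "\<dots> = (\<Sum>X\<in>multisets_of_size A k. \<Prod>x\<in>A. fps_nth G (count X x))"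
    by (rule fps_prod_nth'[OF A(1)])
  also have "\<dots> = (\<Sum>X\<in>multisets_of_size A k. if \<forall>i. count X i \<le> m then 1 else 0)"
  proof (rule sum.cong)
    fix X assume "X \<in> multisets_of_size A k"
    then have "count X i \<le> m" if "i \<notin> A" for i
      using that by (auto simp: multisets_of_size_def not_in_iff subset_iff)
        (metis le0 not_in_iff)
    then have "(\<forall>i. count X i \<le> m) \<longleftrightarrow> (\<forall>i\<in>A. count X i \<le> m)"
      by blast
    moreover have "(\<Prod>x\<in>A. fps_nth G (count X x)) = (if \<forall>i\<in>A. count X i \<le> m then 1 else 0)"
      using A(1) by (auto simp: G_def intro!: prod.neutral)
    ultimately show "(\<Prod>x\<in>A. fps_nth G (count X x)) = (if \<forall>i. count X i \<le> m then 1 else 0)"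
      by simp
  qed simp
  also have "\<dots> = of_nat (card {X \<in> multisets_of_size A k. \<forall>i. count X i \<le> m})"
    using A(1) by (simp add: sum.If_cases Int_def finite_multisets_of_size)
  finally have lhs: "fps_nth (G ^ Suc N) k
      = of_nat (card {X \<in> multisets_of_size A k. \<forall>i. count X i \<le> m})" .
  \<comment> \<open>The geometric sum, in a form that separates numerator and denominator.\<close>
  have "G * (1 - fps_X) = 1 - fps_X ^ Suc m"
    by (rule fps_ext) (auto simp: algebra_simps G_def fps_X_power_nth)
  moreover have "(1 - fps_X :: 'a fps) * inverse (1 - fps_X) = 1"
    by (rule inverse_mult_eq_1') simp
  ultimately have "G = (1 - fps_X ^ Suc m) * inverse (1 - fps_X)"
    by (metis mult.assoc mult.right_neutral)
  then have "G ^ Suc N = (1 - fps_X ^ Suc m) ^ Suc N * inverse ((1 - fps_X) ^ Suc N)"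
    by (metis fps_inverse_power power_mult_distrib)
  also have "(1 - fps_X ^ Suc m :: 'a fps) ^ Suc N
      = (\<Sum>s\<le>Suc N. of_nat (Suc N choose s) * (- (fps_X ^ Suc m)) ^ s)"
    using binomial_ring[of "- (fps_X ^ Suc m) :: 'a fps" 1 "Suc N"] by simp
  also have "\<dots> = (\<Sum>s\<le>Suc N. fps_const ((-1) ^ s * of_nat (Suc N choose s)) * fps_X ^ (s * Suc m))"
  proof (rule sum.cong)
    fix s
    have "(- (fps_X ^ Suc m) :: 'a fps) ^ s = fps_const ((-1) ^ s) * fps_X ^ (s * Suc m)"
      by (subst power_minus)
        (simp add: power_mult [symmetric] mult.commute fps_const_power [symmetric]
          fps_const_neg [symmetric] del: fps_const_neg fps_const_power power_Suc mult_Suc mult_Suc_right)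
    then show "of_nat (Suc N choose s) * (- (fps_X ^ Suc m) :: 'a fps) ^ s
        = fps_const ((-1) ^ s * of_nat (Suc N choose s)) * fps_X ^ (s * Suc m)"
      by (simp add: fps_of_nat [symmetric] mult_ac del: binomial_Suc_Suc power_Suc mult_Suc mult_Suc_right)
  qed simp
  also have "inverse ((1 - fps_X :: 'a fps) ^ Suc N) = Abs_fps (\<lambda>k. of_nat (N + k choose N))"
    using one_minus_const_fps_X_neg_power'[of "Suc N" "1 :: 'a"]
    by (simp add: binomial_symmetric[of N "N + _"] del: power_Suc)
  finally have "fps_nth (G ^ Suc N) k = (\<Sum>s\<le>Suc N. fps_nth (fps_const ((-1) ^ s * of_nat (Suc N choose s))
      * (fps_X ^ (s * Suc m) * Abs_fps (\<lambda>k. of_nat (N + k choose N)))) k)"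
    by (simp add: sum_distrib_right fps_sum_nth mult.assoc
        del: sum.atMost_Suc binomial_Suc_Suc power_Suc mult_Suc mult_Suc_right)
  also have "\<dots> = (\<Sum>s\<le>Suc N. if s * Suc m \<le> k
        then (-1) ^ s * of_nat (Suc N choose s) * of_nat (k - s * Suc m + N choose N) else 0)"
    by (rule sum.cong) (auto simp: fps_X_power_mult_nth add.commute simp del: binomial_Suc_Suc power_Suc mult_Suc mult_Suc_right)
  finally show ?thesis
    using lhs by simp
qed

section \<open>Lattice points of dilated hypersimplices\<close>

lemma size_eq_sum_count_UNIV:
  fixes X :: "'n::finite multiset"
  shows "size X = (\<Sum>i\<in>UNIV. count X i)"
  unfolding size_multiset_overloaded_eq
  by (rule sum.mono_neutral_left) (auto simp: not_in_iff)

text \<open>A multiset \<open>X\<close> stands for its vector of multiplicities, a lattice point of the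
  dilated cube. Such a point of coordinate sum \<open>d * m\<close> is a sum of \<open>m\<close> vertices:
  at most \<open>d\<close> coordinates attain the maximum \<open>m\<close> and at least \<open>d\<close> are positive, so
  there is a set of exactly \<open>d\<close> coordinates in between. Subtracting its vertex leaves a lattice
  point of the next smaller dilation. This integer decomposition avoids describing
  all real points of the hypersimplex by inequalities.\<close>

lemma multiset_in_dilated_hypersimplex:
  fixes X :: "'n::finite multiset"
  assumes d: "d \<le> CARD('n)"
    and "size X = d * m" "\<And>i. count X i \<le> m"
  shows "(\<chi> i. real (count X i)) \<in> (\<lambda>x. real m *\<^sub>R x) ` (hypersimplex d :: (real ^ 'n) set)"
  using assms(2,3)
proof (induction m arbitrary: X)
  case 0
  obtain S :: "'n set" where "card S = d"
    using obtain_subset_with_card_n[OF d] by metis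
  then have "(\<Sum>i\<in>S. axis i 1) \<in> (hypersimplex d :: (real ^ 'n) set)"
    unfolding hypersimplex_def by (intro hull_inc) auto
  then show ?case
    using 0 by (auto simp: vec_eq_iff image_iff)
next
  case (Suc m)
  define F where "F = {i. count X i = Suc m}"
  have "Suc m * card F = (\<Sum>i\<in>F. count X i)"
    by (simp add: F_def)
  also have "\<dots> \<le> (\<Sum>i\<in>UNIV. count X i)"
    by (rule sum_mono2) auto
  also have "\<dots> = Suc m * d"
    using Suc.prems by (simp add: size_eq_sum_count_UNIV [symmetric])
  finally have F: "card F \<le> d"
    by (simp only: Suc_mult_le_cancel1)
  have "Suc m * d = (\<Sum>i\<in>set_mset X. count X i)"
    using Suc.prems by (simp add: size_multiset_overloaded_eq [symmetric])
  also have "\<dots> \<le> (\<Sum>i\<in>set_mset X. Suc m)"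
    by (intro sum_mono Suc.prems)
  also have "\<dots> = Suc m * card (set_mset X)"
    by simp
  finally have "d \<le> card (set_mset X)"
    by (simp only: Suc_mult_le_cancel1)
  moreover have "F \<subseteq> set_mset X"
    by (auto simp: F_def simp flip: count_greater_zero_iff)
  ultimately obtain S where S: "F \<subseteq> S" "S \<subseteq> set_mset X" "card S = d"
    using exists_subset_between[OF F] by auto
  define Y where "Y = X - mset_set S"
  have sub: "mset_set S \<subseteq># X"
    using S(2) by (auto simp: subseteq_mset_def count_mset_set' Suc_le_eq)
  have "size Y = d * m"
    using Suc.prems(1) S(3) by (simp add: Y_def size_Diff_submset[OF sub])
  moreover have "count Y i \<le> m" for i
    using Suc.prems(2)[of i] S(1) by (auto simp: Y_def F_def count_mset_set' le_Suc_eq)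
  ultimately obtain h where h: "h \<in> hypersimplex d" "(\<chi> i. real (count Y i)) = real m *\<^sub>R h"
    using Suc.IH by auto
  define v :: "real ^ 'n" where "v = (\<Sum>i\<in>S. axis i 1)"
  have v: "v \<in> hypersimplex d"
    unfolding hypersimplex_def v_def using S(3) by (intro hull_inc) auto
  have "real (count X i) = real (count Y i) + v $ i" for i
  proof -
    have "count X i = count Y i + count (mset_set S) i"
      using sub by (simp add: Y_def mset_subset_eq_count)
    then show ?thesis
      by (simp add: v_def sum_component axis_def count_mset_set' if_distrib sum.delta cong: if_cong)
  qed
  then have "(\<chi> i. real (count X i)) = real m *\<^sub>R h + v"
    unfolding h(2) [symmetric] by (simp add: vec_eq_iff)
  also have "\<dots> = real (Suc m) *\<^sub>R ((real m / real (Suc m)) *\<^sub>R h + (1 / real (Suc m)) *\<^sub>R v)"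
    by (simp add: scaleR_add_right)
  moreover have "(real m / real (Suc m)) *\<^sub>R h + (1 / real (Suc m)) *\<^sub>R v \<in> hypersimplex d"
    using h(1) v unfolding hypersimplex_def
    by (intro convexD[OF convex_convex_hull]) (auto simp: field_simps)
  ultimately show ?case
    by (intro image_eqI) auto
qed

lemma integer_points_dilated_hypersimplex:
  fixes d m :: nat
  assumes d: "d \<le> CARD('n::finite)"
  shows "(\<lambda>x. real m *\<^sub>R x) ` (hypersimplex d :: (real ^ 'n) set) \<inter> integer_points
    = (\<lambda>X. \<chi> i. real (count X i)) ` {X \<in> multisets_of_size UNIV (d * m). \<forall>i. count X i \<le> m}"
    (is "?L = ?f ` ?M")
proof (rule antisym)
  show "?L \<subseteq> ?f ` ?M"
  proof
    fix x :: "real ^ 'n" assume x: "x \<in> ?L"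
    define H :: "(real ^ 'n) set"
      where "H = {h. (\<forall>i. 0 \<le> h $ i \<and> h $ i \<le> 1) \<and> (\<Sum>i\<in>UNIV. h $ i) = real d}"
    have "convex H"
      unfolding convex_def H_def
      by (auto simp: sum.distrib sum_distrib_left [symmetric] convex_bound_le distrib_right [symmetric])
    moreover have "{(\<Sum>i\<in>S. axis i 1) | S. card S = d} \<subseteq> H"
      by (auto simp: H_def sum_component axis_def if_distrib sum.delta sum.If_cases cong: if_cong)
    ultimately have "hypersimplex d \<subseteq> H"
      unfolding hypersimplex_def by (rule hull_minimal[rotated])
    with x obtain h where h: "h \<in> H" "x = real m *\<^sub>R h" by auto
    define X where "X = (\<Sum>i\<in>UNIV. replicate_mset (nat \<lfloor>x $ i\<rfloor>) i)"
    have cX: "count X i = nat \<lfloor>x $ i\<rfloor>" for i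
      by (simp add: X_def count_sum if_distrib sum.delta cong: if_cong)
    have x0: "0 \<le> x $ i" "x $ i \<le> real m" for i
      using h by (auto simp: H_def mult_left_le)
    have rX: "real (count X i) = x $ i" for i
    proof -
      have "x $ i \<in> \<int>"
        using x by (simp add: integer_points_def)
      then show ?thesis
        using x0[of i] by (simp add: cX)
    qed
    have "real (size X) = (\<Sum>i\<in>UNIV. x $ i)"
      by (simp add: size_eq_sum_count_UNIV rX)
    also have "\<dots> = real (d * m)"
      using h by (simp add: H_def sum_distrib_left [symmetric])
    finally have "size X = d * m"
      by (simp only: of_nat_eq_iff)
    moreover have "count X i \<le> m" for i
      using x0(2)[of i] by (simp flip: rX)
    ultimately show "x \<in> ?f ` ?M"
      by (intro image_eqI[of _ _ X]) (auto simp: vec_eq_iff rX multisets_of_size_def)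
  qed
  show "?f ` ?M \<subseteq> ?L"
    using multiset_in_dilated_hypersimplex[OF d]
    by (auto simp: multisets_of_size_def integer_points_def)
qed

section \<open>The Ehrhart polynomial of the hypersimplex\<close>

text \<open>The closed formula for the Ehrhart polynomial in ambient dimension \<open>Suc N\<close>: the product
  over \<open>j\<close>, divided by \<open>fact N\<close>, is the binomial coefficient of
  \<open>(d - s) * m + N - s\<close> over \<open>N\<close> as a polynomial in \<open>m\<close>.\<close>

definition hypersimplex_ehrhart :: "nat \<Rightarrow> nat \<Rightarrow> complex poly" where
  "hypersimplex_ehrhart d N = (\<Sum>s<d. smult ((-1) ^ s * of_nat (Suc N choose s) / fact N)
     (\<Prod>j=1..N. [: of_nat j - of_nat s, of_nat (d - s) :]))"

text \<open>The count of bounded multisets has a summand \<open>s\<close> only if \<open>s * Suc m \<le> d * m\<close>. The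
  polynomial formula has one for every \<open>s < d\<close>; the additional ones vanish at \<open>m\<close> because
  \<open>(d - s) * m - s\<close> is then a negative integer above \<open>- N\<close>, so that one of the
  factors is zero.\<close>

lemma ehrhart_poly_hypersimplex:
  assumes N: "CARD('n::finite) = Suc N" and d: "0 < d" "d \<le> N"
  shows "ehrhart_poly (hypersimplex d :: (real ^ 'n) set) = hypersimplex_ehrhart d N"
proof (rule ehrhart_poly_eqI)
  fix m :: nat assume m: "m \<ge> 1"
  let ?M = "{X \<in> multisets_of_size (UNIV :: 'n set) (d * m). \<forall>i. count X i \<le> m}"
  have "lattice_point_count (hypersimplex d :: (real ^ 'n) set) m
      = card ((\<lambda>X. \<chi> i. real (count X i) :: real ^ 'n) ` ?M)"
    unfolding lattice_point_count_def using d N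
    by (subst integer_points_dilated_hypersimplex) auto
  also have "\<dots> = card ?M"
    by (rule card_image) (auto simp: inj_on_def vec_eq_iff multiset_eq_iff)
  finally have "complex_of_nat (lattice_point_count (hypersimplex d :: (real ^ 'n) set) m)
      = (\<Sum>s\<le>Suc N. if s * Suc m \<le> d * m then (-1) ^ s * of_nat (Suc N choose s)
            * of_nat (d * m - s * Suc m + N choose N) else 0)"
    using card_bounded_multisets[of "UNIV :: 'n set" N "d * m" m, where 'a = complex] N by simp
  also have "\<dots> = (\<Sum>s<d. if s * Suc m \<le> d * m then (-1) ^ s * of_nat (Suc N choose s)
            * of_nat (d * m - s * Suc m + N choose N) else 0)"
  proof (rule sum.mono_neutral_right)
    show "\<forall>s\<in>{..Suc N} - {..<d}. (if s * Suc m \<le> d * m then (-1) ^ s * of_nat (Suc N choose s)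
            * of_nat (d * m - s * Suc m + N choose N) else 0) = (0 :: complex)"
    proof
      fix s assume "s \<in> {..Suc N} - {..<d}"
      then have "d * m \<le> s * m" "0 < s"
        using d by auto
      then have "d * m < s * Suc m"
        unfolding mult_Suc_right by linarith
      then show "(if s * Suc m \<le> d * m then (-1) ^ s * of_nat (Suc N choose s)
            * of_nat (d * m - s * Suc m + N choose N) else 0) = (0 :: complex)"
        by simp
    qed
  qed (use d in auto)
  also have "\<dots> = (\<Sum>s<d. (-1) ^ s * of_nat (Suc N choose s) / fact N
      * (\<Prod>j=1..N. of_nat j - of_nat s + of_nat m * of_nat (d - s)))"
  proof (rule sum.cong)
    fix s assume "s \<in> {..<d}"
    then have s: "s < d" by simp
    show "(if s * Suc m \<le> d * m then (-1) ^ s * of_nat (Suc N choose s)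
            * of_nat (d * m - s * Suc m + N choose N) else 0)
        = (-1) ^ s * of_nat (Suc N choose s) / fact N
          * (\<Prod>j=1..N. of_nat j - of_nat s + complex_of_nat m * of_nat (d - s))"
    proof (cases "s * Suc m \<le> d * m")
      case True
      have "complex_of_nat (d * m - s * Suc m + N choose N)
          = (\<Prod>j=1..N. of_nat (d * m - s * Suc m) + of_nat j) / fact N"
        by (rule binomial_eq_prod)
      also have "(\<Prod>j=1..N. of_nat (d * m - s * Suc m) + of_nat j)
          = (\<Prod>j=1..N. of_nat j - of_nat s + complex_of_nat m * of_nat (d - s))"
        using True s by (intro prod.cong) (auto simp: of_nat_diff algebra_simps)
      finally show ?thesis
        using True by simp
    next
      case False
      \<comment> \<open>The index of the vanishing factor.\<close>
      define j where "j = s - m * (d - s)"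
      have "m * (d - s) < s"
        using False s by (simp add: diff_mult_distrib2 mult.commute[of m] less_diff_conv2 mult_le_mono1 not_le)
      then have "j \<in> {1..N}" "of_nat j - of_nat s + complex_of_nat m * of_nat (d - s) = 0"
        using s d unfolding j_def by (auto simp: of_nat_diff)
      then have "(\<Prod>j=1..N. of_nat j - of_nat s + complex_of_nat m * of_nat (d - s)) = 0"
        by (intro prod_zero) auto
      then show ?thesis
        using False by simp
    qed
  qed simp
  also have "\<dots> = poly (hypersimplex_ehrhart d N) (of_nat m)"
    by (simp add: hypersimplex_ehrhart_def poly_sum poly_prod)
  finally show "poly (hypersimplex_ehrhart d N) (of_nat m)
      = of_nat (lattice_point_count (hypersimplex d :: (real ^ 'n) set) m)" ..
qed

section \<open>Comparing products of affine factors on the right half plane\<close>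

text \<open>On the right half plane, adding a positive real number to \<open>w\<close> never makes the modulus
  smaller, and flipping the sign of the constant never makes it larger. Hence the quotient of two
  affine factors is bounded by the larger of the two coefficient quotients, uniformly in \<open>w\<close>.\<close>

lemma norm_affine_le:
  fixes w :: complex and c \<kappa> \<rho> \<mu> :: real
  assumes w: "0 \<le> Re w" and l: "0 \<le> \<rho>" "\<rho> \<le> \<mu>" and k: "0 \<le> \<kappa>" and c: "\<bar>c\<bar> \<le> \<mu> * \<kappa>"
  shows "norm (of_real \<rho> * w + of_real c) \<le> \<mu> * norm (w + of_real \<kappa>)"
proof (rule power2_le_imp_le)
  have l2: "\<rho>\<^sup>2 \<le> \<mu>\<^sup>2"
    using l by (rule power_mono[rotated])
  have "\<bar>\<rho> * Re w + c\<bar> \<le> \<mu> * Re w + \<mu> * \<kappa>"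
    using w l c mult_right_mono[OF l(2) w] mult_nonneg_nonneg[OF l(1) w] by linarith
  then have "(\<rho> * Re w + c)\<^sup>2 \<le> (\<mu> * Re w + \<mu> * \<kappa>)\<^sup>2"
    by (metis abs_ge_zero power2_abs power_mono)
  moreover have "(\<rho> * Im w)\<^sup>2 \<le> (\<mu> * Im w)\<^sup>2"
    using l2 by (simp add: power_mult_distrib mult_right_mono)
  moreover have "(norm (of_real \<rho> * w + of_real c))\<^sup>2 = (\<rho> * Re w + c)\<^sup>2 + (\<rho> * Im w)\<^sup>2"
    by (simp add: cmod_power2)
  moreover have "(\<mu> * norm (w + of_real \<kappa>))\<^sup>2 = (\<mu> * Re w + \<mu> * \<kappa>)\<^sup>2 + (\<mu> * Im w)\<^sup>2"
    unfolding power_mult_distrib[of \<mu>] cmod_power2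
    by (simp add: power2_eq_square algebra_simps)
  ultimately show "(norm (of_real \<rho> * w + of_real c))\<^sup>2 \<le> (\<mu> * norm (w + of_real \<kappa>))\<^sup>2"
    by linarith
  show "0 \<le> \<mu> * norm (w + of_real \<kappa>)"
    using l by simp
qed

text \<open>The shifts form an interval \<open>x, x + 1, \<dots>, x + N - 1\<close>, whose element of largest absolute
  value is one of the end points. That factor is compared with the largest factor \<open>w + N\<close> and
  removed. The bound on the end points is inherited by the shorter interval: the
  removed end is replaced by its neighbour, which is closer by \<open>1 \<ge> \<mu>\<close>, and the other end, unless it lies on
  the same side of \<open>0\<close>, has absolute value at most half the number of remaining shifts, which is
  where \<open>1 / 2 \<le> \<mu>\<close> enters.\<close>

lemma prod_norm_le_power:
  fixes w :: complex and x \<rho> \<mu> :: real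
  assumes w: "0 \<le> Re w" and l: "0 \<le> \<rho>" "\<rho> \<le> \<mu>" and m: "1 / 2 \<le> \<mu>" "\<mu> \<le> 1"
    and "x + real N - 1 \<le> \<mu> * real N" "- x \<le> \<mu> * real N"
  shows "(\<Prod>i<N. norm (of_real \<rho> * w + of_real (x + real i)))
    \<le> \<mu> ^ N * (\<Prod>k=1..N. norm (w + of_nat k))"
  using assms(6,7)
proof (induction N arbitrary: x)
  case (Suc N)
  have half: "real N / 2 \<le> \<mu> * real N"
    using mult_right_mono[OF m(1), of "real N"] by simp
  have K: "norm (w + of_real (real (Suc N))) = norm (w + of_nat (Suc N))"
    by simp
  consider "- x \<le> x + real N" | "x + real N \<le> - x" by linarith
  then show ?case
  proof cases
    case 1
    have "\<bar>x + real N\<bar> \<le> \<mu> * real (Suc N)"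
      using 1 Suc.prems by simp
    then have top: "norm (of_real \<rho> * w + of_real (x + real N)) \<le> \<mu> * norm (w + of_nat (Suc N))"
      using norm_affine_le[OF w l, of "real (Suc N)" "x + real N"] unfolding K by simp
    have "x + real N - 1 \<le> \<mu> * real N" "- x \<le> \<mu> * real N"
      using Suc.prems 1 half m by (simp_all add: distrib_left)
    note IH = Suc.IH[OF this]
    have "(\<Prod>i<Suc N. norm (of_real \<rho> * w + of_real (x + real i)))
        = norm (of_real \<rho> * w + of_real (x + real N))
          * (\<Prod>i<N. norm (of_real \<rho> * w + of_real (x + real i)))"
      by simp
    also have "\<dots> \<le> (\<mu> * norm (w + of_nat (Suc N))) * (\<mu> ^ N * (\<Prod>k=1..N. norm (w + of_nat k)))"
      using l by (intro mult_mono top IH prod_nonneg) auto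
    also have "\<dots> = \<mu> ^ Suc N * (\<Prod>k=1..Suc N. norm (w + of_nat k))"
      by simp
    finally show ?thesis .
  next
    case 2
    have "\<bar>x\<bar> \<le> \<mu> * real (Suc N)"
      using 2 Suc.prems by simp
    then have bot: "norm (of_real \<rho> * w + of_real x) \<le> \<mu> * norm (w + of_nat (Suc N))"
      using norm_affine_le[OF w l, of "real (Suc N)"] unfolding K by simp
    have "(x + 1) + real N - 1 \<le> \<mu> * real N" "- (x + 1) \<le> \<mu> * real N"
      using Suc.prems 2 half m by (simp_all add: distrib_left)
    note IH = Suc.IH[OF this]
    have "(\<Prod>i<Suc N. norm (of_real \<rho> * w + of_real (x + real i)))
        = norm (of_real \<rho> * w + of_real x)
          * (\<Prod>i<N. norm (of_real \<rho> * w + of_real (x + 1 + real i)))"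
      unfolding prod.lessThan_Suc_shift by (simp add: add_ac)
    also have "\<dots> \<le> (\<mu> * norm (w + of_nat (Suc N))) * (\<mu> ^ N * (\<Prod>k=1..N. norm (w + of_nat k)))"
      using l by (intro mult_mono bot IH prod_nonneg) auto
    also have "\<dots> = \<mu> ^ Suc N * (\<Prod>k=1..Suc N. norm (w + of_nat k))"
      by simp
    finally show ?thesis .
  qed
qed simp

text \<open>The same removal of end points, but with the exact quotients instead of a common bound.
  Here \<open>A\<close> shifts lie to the left of \<open>0\<close> and \<open>B\<close> to the right, up to rounding, so the
  factor to be removed has shift at most \<open>max A B\<close>, compared with \<open>w + (A + B)\<close>. Since
  \<open>max A B / (A + B) \<ge> 1 / 2 \<ge> \<rho>\<close>, the coefficient \<open>\<rho>\<close> of \<open>w\<close> is never the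
  larger quotient, and the quotients multiply to \<open>fact A * fact B / fact (A + B)\<close>.\<close>

lemma binomial_prod_norm_le:
  fixes w :: complex and x \<rho> :: real
  assumes w: "0 \<le> Re w" and l: "0 \<le> \<rho>" "\<rho> \<le> 1 / 2"
    and "- real A \<le> x" "x \<le> 1 - real A"
  shows "real (A + B choose A) * (\<Prod>i<A+B. norm (of_real \<rho> * w + of_real (x + real i)))
    \<le> (\<Prod>k=1..A+B. norm (w + of_nat k))"
  using assms(4,5)
proof (induction "A + B" arbitrary: A B x)
  case (Suc N)
  have K: "norm (w + of_real (real (Suc N))) = norm (w + of_nat (Suc N))"
    by simp
  consider A' where "B \<le> A" "A = Suc A'" | B' where "A \<le> B" "B = Suc B'"
    using Suc.hyps(2) by (metis add_is_0 nat_le_linear not0_implies_Suc le_zero_eq nat.distinct(1))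
  then show ?case
  proof cases
    case 1
    then have N: "N = A' + B" using Suc.hyps(2) by simp
    have "Suc A' * (A + B choose A) = Suc N * (A' + B choose A')"
      using Suc_times_binomial[of A' "A' + B"] 1 N by simp
    then have ch: "real (A + B choose A) * (real A / real (Suc N)) = real (A' + B choose A')"
      using 1(2) by (simp add: field_simps del: binomial_Suc_Suc flip: of_nat_mult of_nat_Suc)
    have "\<bar>x\<bar> \<le> real A"
      using Suc.prems 1 by simp
    moreover have "\<rho> \<le> real A / real (Suc N)"
      using l 1 N by (intro order_trans[OF l(2)]) (simp add: field_simps)
    ultimately have bot: "norm (of_real \<rho> * w + of_real x)
        \<le> real A / real (Suc N) * norm (w + of_nat (Suc N))"
      using norm_affine_le[OF w l(1), of "real A / real (Suc N)" "real (Suc N)" x] unfolding K by simp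
    have IH: "real (A' + B choose A') * (\<Prod>i<N. norm (of_real \<rho> * w + of_real (x + 1 + real i)))
        \<le> (\<Prod>k=1..N. norm (w + of_nat k))"
      using Suc.hyps(1)[OF N, of "x + 1"] Suc.prems 1 N by simp
    have "real (A + B choose A) * (\<Prod>i<A+B. norm (of_real \<rho> * w + of_real (x + real i)))
      = norm (of_real \<rho> * w + of_real x) *
        (real (A + B choose A) * (\<Prod>i<N. norm (of_real \<rho> * w + of_real (x + 1 + real i))))"
      unfolding Suc.hyps(2) [symmetric] prod.lessThan_Suc_shift by (simp add: add_ac mult_ac)
    also have "\<dots> \<le> (real A / real (Suc N) * norm (w + of_nat (Suc N))) *
        (real (A + B choose A) * (\<Prod>i<N. norm (of_real \<rho> * w + of_real (x + 1 + real i))))"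
      by (intro mult_right_mono bot mult_nonneg_nonneg prod_nonneg) auto
    also have "\<dots> = norm (w + of_nat (Suc N)) *
        (real (A' + B choose A') * (\<Prod>i<N. norm (of_real \<rho> * w + of_real (x + 1 + real i))))"
      unfolding ch [symmetric] by (simp add: mult_ac)
    also have "\<dots> \<le> norm (w + of_nat (Suc N)) * (\<Prod>k=1..N. norm (w + of_nat k))"
      by (intro mult_left_mono IH) auto
    also have "\<dots> = (\<Prod>k=1..A+B. norm (w + of_nat k))"
      unfolding Suc.hyps(2) [symmetric] by simp
    finally show ?thesis .
  next
    case 2
    then have N: "N = A + B'" using Suc.hyps(2) by simp
    have "Suc B' * (A + B choose A) = Suc N * (A + B' choose A)"
      using Suc_times_binomial[of B' "A + B'"] 2 N binomial_symmetric[of A "A + B"]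
        binomial_symmetric[of A "A + B'"] by simp
    then have ch: "real (A + B choose A) * (real B / real (Suc N)) = real (A + B' choose A)"
      using 2(2) by (simp add: field_simps del: binomial_Suc_Suc flip: of_nat_mult of_nat_Suc)
    have "\<bar>x + real N\<bar> \<le> real B"
      using Suc.prems 2 N by simp
    moreover have "\<rho> \<le> real B / real (Suc N)"
      using l 2 N by (intro order_trans[OF l(2)]) (simp add: field_simps)
    ultimately have top: "norm (of_real \<rho> * w + of_real (x + real N))
        \<le> real B / real (Suc N) * norm (w + of_nat (Suc N))"
      using norm_affine_le[OF w l(1), of "real B / real (Suc N)" "real (Suc N)" "x + real N"]
      unfolding K by simp
    have IH: "real (A + B' choose A) * (\<Prod>i<N. norm (of_real \<rho> * w + of_real (x + real i)))
        \<le> (\<Prod>k=1..N. norm (w + of_nat k))"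
      using Suc.hyps(1)[OF N, of x] Suc.prems 2 N by simp
    have "real (A + B choose A) * (\<Prod>i<A+B. norm (of_real \<rho> * w + of_real (x + real i)))
      = norm (of_real \<rho> * w + of_real (x + real N)) *
        (real (A + B choose A) * (\<Prod>i<N. norm (of_real \<rho> * w + of_real (x + real i))))"
      unfolding Suc.hyps(2) [symmetric] by (simp add: mult_ac)
    also have "\<dots> \<le> (real B / real (Suc N) * norm (w + of_nat (Suc N))) *
        (real (A + B choose A) * (\<Prod>i<N. norm (of_real \<rho> * w + of_real (x + real i))))"
      by (intro mult_right_mono top mult_nonneg_nonneg prod_nonneg) auto
    also have "\<dots> = norm (w + of_nat (Suc N)) *
        (real (A + B' choose A) * (\<Prod>i<N. norm (of_real \<rho> * w + of_real (x + real i))))"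
      unfolding ch [symmetric] by (simp add: mult_ac)
    also have "\<dots> \<le> norm (w + of_nat (Suc N)) * (\<Prod>k=1..N. norm (w + of_nat k))"
      by (intro mult_left_mono IH) auto
    also have "\<dots> = (\<Prod>k=1..A+B. norm (w + of_nat k))"
      unfolding Suc.hyps(2) [symmetric] by simp
    finally show ?thesis .
  qed
qed simp

section \<open>Numerical estimates\<close>

text \<open>With \<open>u = n / d - 1\<close> the hypothesis yields \<open>d \<le> u - 1\<close>, hence \<open>n \<le> (u - 1) * (u + 1)\<close>
  and \<open>u \<ge> 5\<close>, a range in which \<open>exp u\<close> exceeds \<open>5 * (u\<^sup>2 - 1)\<close>.\<close>

lemma times_exp_le_fifth:
  fixes n d :: real
  assumes d: "4 \<le> d" and n: "d\<^sup>2 + 2 * d \<le> n"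
  shows "n * exp (1 - n / d) \<le> 1 / 5"
proof -
  define u where "u = n / d - 1"
  have nd: "n = d * (u + 1)" using d by (simp add: u_def)
  have "d + 2 \<le> n / d"
    using d n by (simp add: field_simps power2_eq_square)
  then have du: "d \<le> u - 1" and u: "5 \<le> u" using d by (auto simp: u_def)
  \<comment> \<open>The number \<open>13 / 8\<close> is the quadratic Taylor value of \<open>exp (1 / 2)\<close>.\<close>
  have "(13 / 8) ^ 10 \<le> exp (1 / 2 :: real) ^ 10"
    using exp_lower_Taylor_quadratic[of "1 / 2 :: real"]
    by (intro power_mono) (auto simp: power2_eq_square)
  also have "exp (1 / 2 :: real) ^ 10 = exp 5"
    by (simp add: exp_of_nat_mult [symmetric])
  finally have e5: "120 \<le> exp (5 :: real)"
    by (rule order_trans[rotated]) (simp add: power_divide)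
  have "n \<le> (u - 1) * (u + 1)"
    unfolding nd using du u by (intro mult_right_mono) auto
  then have "5 * n \<le> 5 * ((u - 1) * (u + 1))"
    by simp
  also have "\<dots> \<le> 120 * (1 + (u - 5) + (u - 5)\<^sup>2 / 2)"
  proof -
    have "120 * (1 + (u - 5) + (u - 5)\<^sup>2 / 2) - 5 * ((u - 1) * (u + 1)) = 55 * (u - 5)\<^sup>2 + 70 * (u - 5)"
      by (simp add: power2_eq_square field_simps)
    moreover have "0 \<le> 55 * (u - 5)\<^sup>2 + 70 * (u - 5)"
      using u by (intro add_nonneg_nonneg) auto
    ultimately show ?thesis by linarith
  qed
  also have "\<dots> \<le> exp 5 * exp (u - 5)"
    using u e5 exp_lower_Taylor_quadratic[of "u - 5"] by (intro mult_mono) auto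
  also have "\<dots> = exp u"
    by (simp flip: exp_add)
  finally have "5 * n * exp (- u) \<le> exp u * exp (- u)"
    by (intro mult_right_mono) auto
  then show ?thesis
    by (simp add: u_def flip: exp_add)
qed

text \<open>In this range each step \<open>k \<mapsto> k + 1\<close> multiplies the binomial coefficient by at least
  \<open>2\<close>.\<close>

lemma two_power_binomial_le:
  assumes "s \<le> k" "3 * k \<le> N + 1"
  shows "2 ^ (k - s) * (N choose s) \<le> N choose k"
  using assms
proof (induction k rule: dec_induct)
  case (step k)
  have "2 * Suc k \<le> N - k"
    using step.prems by simp
  then have "Suc k * (2 * (N choose k)) \<le> (N - k) * (N choose k)"
    by (metis mult.assoc mult.commute mult_le_mono1)
  also have "\<dots> = Suc k * (N choose Suc k)"
    using binomial_absorb_comp[of N k] Suc_times_binomial_add binomial_absorption[of k N] by simp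
  finally have "2 * (N choose k) \<le> N choose Suc k"
    by (simp only: Suc_mult_le_cancel1)
  then show ?case
    using step by (simp add: Suc_diff_le)
qed simp

lemma binomial_ge_binomial_if_between:
  fixes A b N :: nat
  assumes "b \<le> A" "A + b \<le> N"
  shows "N choose b \<le> N choose A"
proof (cases "2 * A \<le> N")
  case True
  then show ?thesis using assms binomial_mono by blast
next
  case False
  then have "N choose b \<le> N choose (N - A)"
    using assms by (intro binomial_mono) auto
  then show ?thesis
    using assms by (simp flip: binomial_symmetric)
qed

text \<open>The binomial coefficient over \<open>A\<close> is at least the one over \<open>2 * d\<close>, which lies more than
  \<open>d\<close> doublings above the one over \<open>s\<close>; this outweighs \<open>4 * d\<close>, where a
  factor \<open>2\<close> pays for the passage from row \<open>Suc N\<close> of Pascal's triangle to row \<open>N\<close>.\<close>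

lemma central_binomial_dominates:
  assumes d: "4 \<le> d" and s: "0 < s" "s < d" and N: "6 * d \<le> Suc N"
    and A: "2 * d \<le> A" "A + 2 * d \<le> N"
  shows "2 * d * (Suc N choose s) \<le> N choose A"
proof -
  obtain s' where s': "s = Suc s'" using s gr0_implies_Suc by blast
  have "Suc N choose s \<le> 2 * (N choose s)"
    using binomial_mono[of s' s N] s N by (simp add: s')
  then have "2 * d * (Suc N choose s) \<le> 4 * d * (N choose s)"
    by simp
  also have "4 * d \<le> 2 ^ (d + 1)"
    using d by (induction d rule: dec_induct) auto
  also have "(2::nat) ^ (d + 1) \<le> 2 ^ (2 * d - s)"
    using s by (intro power_increasing) auto
  also have "2 ^ (2 * d - s) * (N choose s) \<le> N choose (2 * d)"
    using s N by (intro two_power_binomial_le) auto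
  also have "\<dots> \<le> N choose A"
    using A by (intro binomial_ge_binomial_if_between) auto
  finally show ?thesis by simp
qed

section \<open>Dominance of the first summand\<close>

text \<open>The modulus of the \<open>s\<close>-th product of the Ehrhart polynomial in the coordinate
  \<open>w = - d * a - n\<close>, \<open>n = Suc N\<close>, which turns the half plane \<open>Re a \<le> - n / d\<close> into
  \<open>Re w \<ge> 0\<close>. The factors are listed by increasing shift, that is, by decreasing \<open>j\<close>.\<close>

definition shifted_prod :: "nat \<Rightarrow> nat \<Rightarrow> nat \<Rightarrow> complex \<Rightarrow> real" where
  "shifted_prod d N s w = (\<Prod>i<N. norm (of_real (1 - real s / real d) * w
     + of_real (1 - real s * (real (Suc N) / real d - 1) + real i)))"

lemma shifted_prod_0: "shifted_prod d N 0 w = (\<Prod>k=1..N. norm (w + of_nat k))"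
  by (simp add: shifted_prod_def prod.atLeast1_atMost_eq add_ac)

lemma norm_ehrhart_factors:
  assumes d: "0 < d" and s: "s \<le> d" and a: "a = - (w + of_nat (Suc N)) / of_nat d"
  shows "norm (\<Prod>j=1..N. of_nat j - of_nat s + a * of_nat (d - s)) = shifted_prod d N s w"
proof -
  have "(\<Prod>j=1..N. of_nat j - of_nat s + a * of_nat (d - s))
      = (\<Prod>i<N. of_nat (Suc i) - of_nat s + a * of_nat (d - s))"
    by (simp add: prod.atLeast1_atMost_eq)
  also have "\<dots> = (\<Prod>i<N. of_nat (Suc (N - Suc i)) - of_nat s + a * of_nat (d - s))"
    by (rule prod.nat_diff_reindex [symmetric])
  also have "\<dots> = (\<Prod>i<N. - (of_real (1 - real s / real d) * w
     + of_real (1 - real s * (real (Suc N) / real d - 1) + real i)))"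
  proof (rule prod.cong)
    fix i assume "i \<in> {..<N}"
    then have "Suc (N - Suc i) = N - i" "i \<le> N" by auto
    then show "of_nat (Suc (N - Suc i)) - of_nat s + a * of_nat (d - s)
      = - (of_real (1 - real s / real d) * w
         + of_real (1 - real s * (real (Suc N) / real d - 1) + real i))"
      using d s by (simp add: a of_nat_diff field_simps)
  qed simp
  finally show ?thesis
    unfolding shifted_prod_def by (simp only: prod_norm [symmetric] norm_minus_cancel)
qed

text \<open>For \<open>s \<le> d / 2\<close> the interval of shifts begins at \<open>1 - t\<close> with \<open>t \<le> N / 2\<close>, so its
  larger end is \<open>N - t\<close> and every factor contributes at most \<open>1 - t / N\<close>. The \<open>N\<close>-th power of
  this is at most \<open>exp (- t)\<close>, the \<open>s\<close>-th power of \<open>exp (1 - n / d)\<close>.\<close>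

lemma small_shift_bound:
  assumes d: "0 < d" "d \<le> N" and w: "0 \<le> Re w" and s: "2 * s \<le> d"
  shows "real (Suc N choose s) * shifted_prod d N s w
    \<le> (real (Suc N) * exp (1 - real (Suc N) / real d)) ^ s * (\<Prod>k=1..N. norm (w + of_nat k))"
proof -
  define n where "n = real (Suc N)"
  define t where "t = real s * (n / real d - 1)"
  define \<mu> where "\<mu> = 1 - t / real N"
  have N: "real N = n - 1" "0 < real N" and n: "real d + 1 \<le> n"
    using d by (auto simp: n_def)
  have t_eq: "t = real s / real d * (n - real d)"
    using d by (simp add: t_def field_simps)
  have half: "real s / real d \<le> 1 / 2"
    using s d by (simp add: field_simps)
  have t0: "0 \<le> t"
    using n unfolding t_eq by (intro mult_nonneg_nonneg) auto
  have "t \<le> 1 / 2 * (n - real d)"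
    unfolding t_eq using n half by (intro mult_right_mono) auto
  then have t2: "2 * t \<le> real N"
    using N d by simp
  have "t \<le> real s / real d * real N"
    unfolding t_eq N using d by (intro mult_left_mono) auto
  then have "t / real N \<le> real s / real d"
    using N by (simp add: divide_le_eq)
  then have rho: "1 - real s / real d \<le> \<mu>"
    by (simp add: \<mu>_def)
  have \<mu>N: "\<mu> * real N = real N - t"
    using N by (simp add: \<mu>_def field_simps)
  have "shifted_prod d N s w \<le> \<mu> ^ N * (\<Prod>k=1..N. norm (w + of_nat k))"
    unfolding shifted_prod_def n_def [symmetric] t_def [symmetric]
  proof (rule prod_norm_le_power[OF w])
    show "0 \<le> 1 - real s / real d" "1 / 2 \<le> \<mu>"
      using half rho by linarith+
    show "\<mu> \<le> 1"
      using t0 by (simp add: \<mu>_def)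
    show "1 - t + real N - 1 \<le> \<mu> * real N" "- (1 - t) \<le> \<mu> * real N"
      using t2 by (auto simp: \<mu>N)
  qed (fact rho)
  also have "\<mu> ^ N \<le> exp (- t)"
    unfolding \<mu>_def using N t2 t0 by (intro exp_ge_one_minus_x_over_n_power_n) auto
  also have "exp (- t) = exp (1 - n / real d) ^ s"
    unfolding t_def by (simp add: exp_of_nat_mult [symmetric] algebra_simps)
  finally have T: "shifted_prod d N s w
      \<le> exp (1 - n / real d) ^ s * (\<Prod>k=1..N. norm (w + of_nat k))"
    by (simp add: mult_right_mono prod_nonneg)
  have "real (Suc N choose s) \<le> n ^ s"
    using binomial_le_pow[of s "Suc N"] s d
    unfolding n_def of_nat_power [symmetric] of_nat_le_iff by simp
  from mult_mono[OF this T] show ?thesis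
    by (simp add: n_def power_mult_distrib mult.assoc shifted_prod_def prod_nonneg)
qed

text \<open>For \<open>s \<ge> d / 2\<close> the coefficient \<open>1 - s / d\<close> of \<open>w\<close> is at most \<open>1 / 2\<close>, and the quotient of
  the products is bounded by a reciprocal binomial coefficient over \<open>A\<close>, the integer part of the
  shift \<open>t\<close>. The hypothesis on \<open>n\<close> keeps \<open>A\<close> at distance at least \<open>2 * d\<close> from both
  ends of \<open>{0..N}\<close>: for \<open>s = d - 1\<close> the distance from \<open>N\<close> is where \<open>n \<ge> d\<^sup>2 + 2 * d\<close> is used
  sharply.\<close>

lemma large_shift_bound:
  assumes d: "4 \<le> d" "d\<^sup>2 + 2 * d \<le> Suc N" and w: "0 \<le> Re w" and s: "d \<le> 2 * s" "s < d"
  shows "2 * real d * real (Suc N choose s) * shifted_prod d N s w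
    \<le> (\<Prod>k=1..N. norm (w + of_nat k))"
proof -
  define n where "n = real (Suc N)"
  define t where "t = real s * (n / real d - 1)"
  define A where "A = nat \<lfloor>t\<rfloor>"
  have "real (d\<^sup>2 + 2 * d) \<le> n"
    using d(2) unfolding n_def of_nat_le_iff .
  then have nd: "real d + 2 \<le> n / real d"
    using d by (simp add: field_simps power2_eq_square)
  have "2 * (real d + 1) \<le> t"
    unfolding t_def using s d nd by (intro mult_mono) auto
  then have t: "0 \<le> t" "2 * real d \<le> t"
    by (auto intro: order_trans[rotated])
  have "real A = of_int \<lfloor>t\<rfloor>"
    using t(1) by (simp add: A_def)
  then have A: "real A \<le> t" "t \<le> real A + 1"
    by linarith+
  have "t \<le> (real d - 1) * (n / real d - 1)"
    unfolding t_def
  proof (rule mult_right_mono)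
    show "real s \<le> real d - 1" using s by simp
    show "0 \<le> n / real d - 1" using nd by linarith
  qed
  also have "\<dots> = n - real d - n / real d + 1"
    using d by (simp add: field_simps)
  finally have "t \<le> real N - 2 * real d"
    using nd by (simp add: n_def)
  then have A2: "A + 2 * d \<le> N"
    using A(1) by linarith
  have A1: "2 * d \<le> A"
    using t(2) unfolding A_def by (simp add: le_nat_floor)
  have N6: "6 * d \<le> Suc N"
  proof -
    have "4 * d \<le> d\<^sup>2" using d by (simp add: power2_eq_square)
    with d(2) show ?thesis by linarith
  qed
  have "2 * d * (Suc N choose s) \<le> N choose A"
    using d s N6 A1 A2 by (intro central_binomial_dominates) auto
  then have "real (2 * d * (Suc N choose s)) \<le> real (N choose A)"
    by (simp only: of_nat_le_iff)
  then have "2 * real d * real (Suc N choose s) * shifted_prod d N s w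
      \<le> real (N choose A) * shifted_prod d N s w"
    by (intro mult_right_mono) (auto simp: shifted_prod_def intro: prod_nonneg)
  also have "\<dots> \<le> (\<Prod>k=1..N. norm (w + of_nat k))"
  proof -
    have "N = A + (N - A)" using A2 by simp
    moreover have "0 \<le> 1 - real s / real d" "1 - real s / real d \<le> 1 / 2"
      using s by (auto simp: field_simps)
    ultimately show ?thesis
      using binomial_prod_norm_le[OF w, of "1 - real s / real d" A "1 - t" "N - A"] A
      unfolding shifted_prod_def n_def [symmetric] t_def [symmetric] by simp
  qed
  finally show ?thesis .
qed

text \<open>Relative to the summand for \<open>s = 0\<close>, the summands with \<open>2 * s \<le> d\<close> are bounded by a geometric
  series with quotient \<open>1 / 5\<close>, and each of the fewer than \<open>d\<close> others by \<open>1 / (2 * d)\<close>. In total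
  this is less than \<open>1 / 4 + 1 / 2\<close>.\<close>

lemma sum_shifted_prod_less:
  assumes d: "4 \<le> d" "d\<^sup>2 + 2 * d \<le> Suc N" and w: "0 \<le> Re w"
  shows "(\<Sum>s=1..<d. real (Suc N choose s) * shifted_prod d N s w) < shifted_prod d N 0 w"
proof -
  define P where "P = (\<Prod>k=1..N. norm (w + of_nat k))"
  define q where "q = real (Suc N) * exp (1 - real (Suc N) / real d)"
  have "norm (w + of_nat k) > 0" if "k \<in> {1..N}" for k
  proof -
    have "Re (w + of_nat k) > 0" using w that by simp
    then show ?thesis
      using complex_Re_le_cmod[of "w + of_nat k"] by linarith
  qed
  then have P: "P > 0"
    unfolding P_def by (intro prod_pos)
  have "d < Suc N" using d by simp
  have q: "0 \<le> q" "q \<le> 1 / 5"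
  proof -
    have "real (d\<^sup>2 + 2 * d) \<le> real (Suc N)"
      using d(2) by (simp only: of_nat_le_iff)
    then show "q \<le> 1 / 5"
      unfolding q_def using d by (intro times_exp_le_fifth) auto
  qed (simp add: q_def)
  have bound: "real (Suc N choose s) * shifted_prod d N s w \<le> ((1 / 5) ^ s + 1 / (2 * real d)) * P"
    if "s \<in> {1..<d}" for s
  proof (cases "2 * s \<le> d")
    case True
    have "real (Suc N choose s) * shifted_prod d N s w \<le> q ^ s * P"
      unfolding P_def q_def using d w True \<open>d < Suc N\<close> by (intro small_shift_bound) auto
    also have "\<dots> \<le> ((1 / 5) ^ s + 1 / (2 * real d)) * P"
      using P q power_mono[of q "1 / 5" s] by (intro mult_right_mono add_increasing2) auto
    finally show ?thesis .
  next
    case False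
    have "2 * real d * real (Suc N choose s) * shifted_prod d N s w \<le> P"
      unfolding P_def using d w False that by (intro large_shift_bound) auto
    then have "real (Suc N choose s) * shifted_prod d N s w \<le> 1 / (2 * real d) * P"
      using d by (simp add: field_simps)
    also have "\<dots> \<le> ((1 / 5) ^ s + 1 / (2 * real d)) * P"
      using P by (intro mult_right_mono) auto
    finally show ?thesis .
  qed
  have "(\<Sum>s=1..<d. real (Suc N choose s) * shifted_prod d N s w)
      \<le> (\<Sum>s=1..<d. ((1 / 5) ^ s + 1 / (2 * real d)) * P)"
    by (intro sum_mono bound)
  also have "\<dots> = ((\<Sum>s=1..<d. (1 / 5) ^ s) + (real d - 1) / (2 * real d)) * P"
    using d by (simp add: sum.distrib of_nat_diff flip: sum_distrib_right)
  also have "\<dots> < 1 * P"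
  proof (intro mult_strict_right_mono P)
    have "(\<Sum>s=1..<Suc m. (1 / 5 :: real) ^ s) = (1 - (1 / 5) ^ m) / 4" for m
    proof (induction m)
      case (Suc m)
      have "(\<Sum>s=1..<Suc (Suc m). (1 / 5 :: real) ^ s) = (\<Sum>s=1..<Suc m. (1 / 5) ^ s) + (1 / 5) ^ Suc m"
        by (rule sum.atLeastLessThan_Suc) simp
      then show ?case
        unfolding Suc.IH by simp
    qed simp
    from this[of "d - 1"] have "(\<Sum>s=1..<d. (1 / 5 :: real) ^ s) \<le> 1 / 4"
      using d by simp
    moreover have "(real d - 1) / (2 * real d) \<le> 1 / 2"
      using d by (simp add: field_simps)
    ultimately show "(\<Sum>s=1..<d. (1 / 5) ^ s) + (real d - 1) / (2 * real d) < 1"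
      by linarith
  qed
  finally show ?thesis
    by (simp add: shifted_prod_0 P_def)
qed

text \<open>At a root the summand for \<open>s = 0\<close> would equal the negative of the sum of all others, whose
  moduli add up to less.\<close>

lemma hypersimplex_ehrhart_nonzero:
  assumes d: "4 \<le> d" "d\<^sup>2 + 2 * d \<le> Suc N" and a: "Re a \<le> - (real (Suc N) / real d)"
  shows "poly (hypersimplex_ehrhart d N) a \<noteq> 0"
proof
  assume root: "poly (hypersimplex_ehrhart d N) a = 0"
  define w where "w = - (of_nat d * a) - of_nat (Suc N)"
  have "real d * Re a \<le> real d * (- (real (Suc N) / real d))"
    using a by (intro mult_left_mono) auto
  then have w: "0 \<le> Re w"
    using d by (simp add: w_def)
  have aw: "a = - (w + of_nat (Suc N)) / of_nat d"
    using d by (simp add: w_def)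
  define c where "c s = (-1) ^ s * of_nat (Suc N choose s)
      * (\<Prod>j=1..N. of_nat j - of_nat s + a * of_nat (d - s))" for s
  have nc: "norm (c s) = real (Suc N choose s) * shifted_prod d N s w" if "s \<le> d" for s
    using d that unfolding c_def norm_mult
    by (subst norm_ehrhart_factors[OF _ that aw]) (auto simp: norm_power simp del: binomial_Suc_Suc)
  have "(\<Sum>s<d. c s) = fact N * poly (hypersimplex_ehrhart d N) a"
    by (simp add: hypersimplex_ehrhart_def poly_sum poly_prod c_def sum_distrib_left)
  also have "\<dots> = 0"
    using root by simp
  finally have "c 0 + (\<Sum>s=1..<d. c s) = 0"
    using d by (simp add: sum.atLeast_Suc_lessThan flip: atLeast0LessThan)
  then have "norm (c 0) = norm (\<Sum>s=1..<d. c s)"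
    by (metis add_eq_0_iff norm_minus_cancel)
  also have "\<dots> \<le> (\<Sum>s=1..<d. norm (c s))"
    by (rule norm_sum)
  also have "\<dots> = (\<Sum>s=1..<d. real (Suc N choose s) * shifted_prod d N s w)"
    by (intro sum.cong nc) auto
  also have "\<dots> < shifted_prod d N 0 w"
    using d w by (rule sum_shifted_prod_less)
  finally show False
    using nc[of 0] by simp
qed

theorem theorem3p2:
  fixes d :: nat and a :: complex
  assumes "d \<ge> 4"
    and "CARD('n::finite) \<ge> d\<^sup>2 + 2 * d"
    and "poly (ehrhart_poly (hypersimplex d :: (real ^ 'n) set)) a = 0"
  shows "- (real CARD('n) / real d) < Re a"
proof (rule ccontr)
  assume "\<not> - (real CARD('n) / real d) < Re a"
  obtain N where N: "CARD('n) = Suc N"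
    using not0_implies_Suc[of "CARD('n)"] by auto
  then have "0 < d" "d \<le> N"
    using assms(1,2) by auto
  then have "poly (hypersimplex_ehrhart d N) a = 0"
    using assms(3) by (simp add: ehrhart_poly_hypersimplex[OF N])
  moreover have "poly (hypersimplex_ehrhart d N) a \<noteq> 0"
    using assms(1,2) \<open>\<not> - (real CARD('n) / real d) < Re a\<close> unfolding N by (intro hypersimplex_ehrhart_nonzero) auto
  ultimately show False by contradiction
qed

end
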